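(* Let $q$ be a prime power and $2\le d\le q$, and consider the corner code $\mathsf{H}^{0}_d$. Then the points $(\overline{x}_1,\overline{y}_1),\dots,(\overline{x}_d,\overline{y}_d)$ of $\mathcal{H}$ corresponding to any minimum-weight word of $\mathsf{H}^{0}_d$ lie on the same line.
   Context: Let $\mathcal{H}$ be the Hermitian curve $x^{q+1}=y^q+y$ in the affine plane $(\mathbb{F}_{q^2})^2$, with its $n=q^3$ affine $\mathbb{F}_{q^2}$-rational points $P_1,\dots,P_n$. For an integer $m$ let $\mathcal{B}_{m,q}=\{x^ry^s : qr+(q+1)s\le m,\ 0\le s\le q-1,\ 0\le r\le q^2-1\}$, and let the Hermitian code $C(m,q)$ be the set of $c\in(\mathbb{F}_{q^2})^n$ with $\sum_{i=1}^n c_i f(P_i)=0$ for all $f\in\mathcal{B}_{m,q}$. For $2\le d\le q$, the corner code $\mathsf{H}^{0}_d$ is the Hermitian code $C(m,q)$ for which $\mathcal{B}_{m,q}=\{x^ry^s: r,s\ge 0,\ r+s\le d-2\}$; it has minimum distance $d$. The points corresponding to a codeword $c$ are the points $P_i$ with $c_i\neq0$. Lines are lines of the affine plane $(\mathbb{F}_{q^2})^2$. *)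

theory Defs
  imports
    "HOL-Library.FuncSet"
    "HOL-Library.Cardinality"
    "HOL-Computational_Algebra.Polynomial"
    "HOL-Number_Theory.Prime_Powers"
begin

definition hermitian_curve :: "nat \<Rightarrow> ('a::{finite,field} \<times> 'a) set" where
  "hermitian_curve q = {(x, y). x ^ (q + 1) = y ^ q + y}"

text \<open>
  Bivariate polynomials are of type \<^typ>\<open>'a poly poly\<close>: the inner variable is \<open>x\<close>,
  the outer variable is \<open>y\<close>.
\<close>

definition xy_monom :: "nat \<Rightarrow> nat \<Rightarrow> 'a::comm_ring_1 poly poly" where
  "xy_monom r s = monom (monom 1 r) s"

definition eval_xy :: "'a::comm_ring_1 poly poly \<Rightarrow> 'a \<times> 'a \<Rightarrow> 'a" where
  "eval_xy f p = poly (poly f [:snd p:]) (fst p)"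

lemma eval_xy_monom: "eval_xy (xy_monom r s) (x, y) = x ^ r * y ^ s"
  by (simp add: eval_xy_def xy_monom_def poly_monom)

definition hermitian_basis :: "int \<Rightarrow> nat \<Rightarrow> 'a::{finite,field} poly poly set" where
  "hermitian_basis m q =
     {xy_monom r s | r s. int (q * r + (q + 1) * s) \<le> m \<and> s \<le> q - 1 \<and> r \<le> q\<^sup>2 - 1}"

text \<open>
  Words of length \<open>n\<close> are extensional functions on \<open>{1..n}\<close>. The enumeration \<open>P\<close> of the
  points of the curve is a parameter.
\<close>

definition hermitian_code ::
    "(nat \<Rightarrow> 'a::{finite,field} \<times> 'a) \<Rightarrow> int \<Rightarrow> nat \<Rightarrow> (nat \<Rightarrow> 'a) set" where
  "hermitian_code P m q =
     {c \<in> {1..q ^ 3} \<rightarrow>\<^sub>E UNIV. \<forall>f \<in> hermitian_basis m q. (\<Sum>i = 1..q ^ 3. c i * eval_xy f (P i)) = 0}"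

text \<open>
  Several \<open>m\<close> may have the required monomial set, but they all give the same code. For
  \<open>2 \<le> d \<le> q\<close> such an \<open>m\<close> exists, see \<open>corner_basis_exists\<close>.
\<close>

definition is_corner_code ::
    "(nat \<Rightarrow> 'a::{finite,field} \<times> 'a) \<Rightarrow> nat \<Rightarrow> nat \<Rightarrow> (nat \<Rightarrow> 'a) set \<Rightarrow> bool" where
  "is_corner_code P q d C \<longleftrightarrow>
     (\<exists>m. (hermitian_basis m q :: 'a poly poly set) = {xy_monom r s | r s. r + s \<le> d - 2} \<and>
          C = hermitian_code P m q)"

lemma corner_basis_exists:
  assumes "2 \<le> d" "d \<le> q"
  shows "hermitian_basis (int ((q + 1) * (d - 2))) q =
           ({xy_monom r s | r s. r + s \<le> d - 2} :: 'a::{finite,field} poly poly set)"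
proof -
  obtain k where k: "d = k + 2" using assms(1) by (metis add.commute le_Suc_ex)
  have "(int (q * r + (q + 1) * s) \<le> int ((q + 1) * (d - 2)) \<and> s \<le> q - 1 \<and> r \<le> q\<^sup>2 - 1)
          \<longleftrightarrow> r + s \<le> d - 2" (is "?L \<longleftrightarrow> ?R") for r s
  proof
    assume ?L
    then have le: "q * r + (q + 1) * s \<le> (q + 1) * (d - 2)"
      by linarith
    show ?R
    proof (rule ccontr)
      assume "\<not> ?R"
      then have "d - 2 + 1 \<le> r + s" by simp
      then have "q * (d - 2 + 1) \<le> q * (r + s)" by (rule mult_le_mono2)
      with le assms show False by (simp add: k algebra_simps)
    qed
  next
    assume R: ?R
    then have "(q + 1) * (r + s) \<le> (q + 1) * (d - 2)" by (rule mult_le_mono2)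
    then have "q * r + (q + 1) * s \<le> (q + 1) * (d - 2)" by (simp add: algebra_simps)
    moreover have "q * 1 \<le> q * q" using assms by (intro mult_le_mono2) simp
    ultimately show ?L using R assms unfolding power2_eq_square of_nat_le_iff by linarith
  qed
  then show ?thesis unfolding hermitian_basis_def by simp
qed

definition word_support :: "nat \<Rightarrow> (nat \<Rightarrow> 'a::zero) \<Rightarrow> nat set" where
  "word_support n c = {i \<in> {1..n}. c i \<noteq> 0}"

definition hamming_weight :: "nat \<Rightarrow> (nat \<Rightarrow> 'a::zero) \<Rightarrow> nat" where
  "hamming_weight n c = card (word_support n c)"

definition minimum_weight_word :: "nat \<Rightarrow> (nat \<Rightarrow> 'a::zero) set \<Rightarrow> (nat \<Rightarrow> 'a) \<Rightarrow> bool" where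
  "minimum_weight_word n C c \<longleftrightarrow>
     c \<in> C \<and> hamming_weight n c \<noteq> 0 \<and>
     (\<forall>c' \<in> C. hamming_weight n c' \<noteq> 0 \<longrightarrow> hamming_weight n c \<le> hamming_weight n c')"

definition word_points ::
    "(nat \<Rightarrow> 'a \<times> 'a) \<Rightarrow> nat \<Rightarrow> (nat \<Rightarrow> 'a::zero) \<Rightarrow> ('a \<times> 'a) set" where
  "word_points P n c = P ` word_support n c"

definition affine_line :: "('a::field \<times> 'a) set \<Rightarrow> bool" where
  "affine_line L \<longleftrightarrow> (\<exists>a b e. (a, b) \<noteq> (0, 0) \<and> L = {(x, y). a * x + b * y = e})"

end

theory Submission
  imports Defs
begin

text \<open>
  Some vertical line meets the curve in at least \<open>q\<close> points, since the \<open>q\<^sup>3\<close> points have only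
  \<open>q\<^sup>2\<close> possible abscissae. On \<open>d\<close> points of such a line the parity checks reduce to the
  \<open>d - 1\<close> conditions given by \<open>1, y, \<dots>, y\<^bsup>d-2\<^esup>\<close>, so the code has a nonzero word of weight at
  most \<open>d\<close>. Conversely, a product of at most \<open>d - 2\<close> affine functions is orthogonal to the code,
  so it cannot vanish at all points of a word but one. This rules out fewer than \<open>d\<close> points
  (one line for each point but one), and also \<open>d\<close> points that are not collinear (one line
  through two of the points, and one line for each of \<open>d - 3\<close> others).
\<close>

section \<open>Products of affine functions\<close>

definition affine_form :: "'a \<times> 'a \<times> 'a \<Rightarrow> 'a \<times> 'a \<Rightarrow> 'a::comm_ring_1" where
  "affine_form l p = fst l * fst p + fst (snd l) * snd p + snd (snd l)"

text \<open>Multiplying out the product leaves only monomials of degree at most \<open>k\<close>.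
  The factor of degree \<open>r + s\<close> is carried along for the induction: expanding the first
  affine factor shortens the list and raises \<open>r\<close> or \<open>s\<close> by at most
  one.\<close>

lemma sum_prod_list_affine_eq_0:
  fixes w :: "'a \<times> 'a \<Rightarrow> 'a::comm_ring_1"
  assumes "\<And>r s. r + s \<le> k \<Longrightarrow> (\<Sum>p\<in>S. w p * (fst p ^ r * snd p ^ s)) = 0"
    and "r + s + length ls \<le> k"
  shows "(\<Sum>p\<in>S. w p * (fst p ^ r * snd p ^ s) * (\<Prod>l\<leftarrow>ls. affine_form l p)) = 0"
  using assms(2)
proof (induction ls arbitrary: r s)
  case Nil
  then show ?case using assms(1) by simp
next
  case (Cons l ls)
  obtain a b e where l: "l = (a, b, e)" by (cases l)
  let ?M = "\<lambda>r s. \<Sum>p\<in>S. w p * (fst p ^ r * snd p ^ s) * (\<Prod>l\<leftarrow>ls. affine_form l p)"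
  have "(\<Sum>p\<in>S. w p * (fst p ^ r * snd p ^ s) * (\<Prod>l\<leftarrow>l # ls. affine_form l p)) =
        a * ?M (Suc r) s + b * ?M r (Suc s) + e * ?M r s"
    unfolding sum_distrib_left sum.distrib[symmetric]
    by (rule sum.cong) (simp_all add: l affine_form_def algebra_simps)
  also have "?M (Suc r) s = 0" by (rule Cons.IH) (use Cons.prems in simp)
  also have "?M r (Suc s) = 0" by (rule Cons.IH) (use Cons.prems in simp)
  also have "?M r s = 0" by (rule Cons.IH) (use Cons.prems in simp)
  finally show ?case by simp
qed

text \<open>Two distinct points differ in a coordinate, so a vertical or a horizontal line does
  it.\<close>

lemma affine_form_separates:
  fixes p t :: "'a::comm_ring_1 \<times> 'a"
  assumes "t \<noteq> p"
  obtains l where "affine_form l t = 0" "affine_form l p \<noteq> 0"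
proof (cases "fst t = fst p")
  case True
  with assms have "snd t \<noteq> snd p" by (simp add: prod_eq_iff)
  then show ?thesis using that[of "(0, 1, - snd t)"] by (simp add: affine_form_def)
next
  case False
  then show ?thesis using that[of "(1, 0, - fst t)"] by (simp add: affine_form_def)
qed

lemma prod_list_affine_separates:
  fixes p :: "'a::idom \<times> 'a"
  assumes "finite T" "p \<notin> T"
  obtains ls where "length ls = card T" "(\<Prod>l\<leftarrow>ls. affine_form l p) \<noteq> 0"
    "\<And>t. t \<in> T \<Longrightarrow> (\<Prod>l\<leftarrow>ls. affine_form l t) = 0"
proof -
  have "\<exists>ls. length ls = card T \<and> (\<Prod>l\<leftarrow>ls. affine_form l p) \<noteq> 0 \<and>
      (\<forall>t\<in>T. (\<Prod>l\<leftarrow>ls. affine_form l t) = 0)"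
    using assms
  proof (induction T rule: finite_induct)
    case empty
    show ?case by (intro exI[of _ "[]"]) simp
  next
    case (insert t T)
    then obtain ls where ls: "length ls = card T" "(\<Prod>l\<leftarrow>ls. affine_form l p) \<noteq> 0"
      "\<forall>t\<in>T. (\<Prod>l\<leftarrow>ls. affine_form l t) = 0" by auto
    obtain l where "affine_form l t = 0" "affine_form l p \<noteq> 0"
      using affine_form_separates[of t p] insert.prems by auto
    with ls insert.hyps show ?case by (intro exI[of _ "l # ls"]) auto
  qed
  then show ?thesis using that by blast
qed

lemma affine_line_affine_form:
  assumes "(a, b) \<noteq> (0, 0)"
  shows "affine_line {p. affine_form (a, b, e) p = 0}"
  unfolding affine_line_def
  by (intro exI[of _ a] exI[of _ b] exI[of _ "- e"] conjI assms)
    (auto simp: affine_form_def eq_neg_iff_add_eq_0)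

lemma affine_line_through:
  fixes u v :: "'a::field \<times> 'a"
  assumes "u \<noteq> v"
  obtains l where "affine_line {p. affine_form l p = 0}" "affine_form l u = 0" "affine_form l v = 0"
proof
  \<comment> \<open>Up to sign, the form is the determinant of the vectors from \<open>u\<close> to
    \<open>v\<close> and from \<open>u\<close> to the variable point.\<close>
  let ?a = "snd v - snd u" and ?b = "fst u - fst v"
  let ?l = "(?a, ?b, - (?a * fst u + ?b * snd u))"
  have "(?a, ?b) \<noteq> (0, 0)" using assms by (auto simp: prod_eq_iff)
  then show "affine_line {p. affine_form ?l p = 0}"
    by (rule affine_line_affine_form)
  show "affine_form ?l u = 0" "affine_form ?l v = 0"
    by (simp_all add: affine_form_def algebra_simps)
qed

section \<open>Sets of points with vanishing moments\<close>

text \<open>The product has weighted sum zero over \<open>S\<close>, and the term at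
  \<open>p\<close> is the only one that can survive.\<close>

lemma prod_list_affine_not_isolating:
  fixes w :: "'a \<times> 'a \<Rightarrow> 'a::idom"
  assumes "finite S" "p \<in> S" "w p \<noteq> 0"
    and "\<And>r s. r + s \<le> k \<Longrightarrow> (\<Sum>p\<in>S. w p * (fst p ^ r * snd p ^ s)) = 0"
    and "length ls \<le> k"
    and "\<And>t. t \<in> S - {p} \<Longrightarrow> (\<Prod>l\<leftarrow>ls. affine_form l t) = 0"
  shows "(\<Prod>l\<leftarrow>ls. affine_form l p) = 0"
proof -
  have "0 = (\<Sum>t\<in>S. w t * (\<Prod>l\<leftarrow>ls. affine_form l t))"
    using sum_prod_list_affine_eq_0[where r = 0 and s = 0, OF assms(4)] assms(5) by simp
  also have "\<dots> = w p * (\<Prod>l\<leftarrow>ls. affine_form l p)"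
    using assms by (simp add: sum.remove[of S p])
  finally show ?thesis using assms(3) by simp
qed

text \<open>If \<open>S\<close> had at most \<open>k + 1\<close> points, one line for each point
  other than \<open>p\<close> would give a product of at most \<open>k\<close> factors isolating
  \<open>p\<close>.\<close>

lemma card_gt_of_moments_eq_0:
  fixes w :: "'a \<times> 'a \<Rightarrow> 'a::idom"
  assumes "finite S" "S \<noteq> {}" "\<And>p. p \<in> S \<Longrightarrow> w p \<noteq> 0"
    and "\<And>r s. r + s \<le> k \<Longrightarrow> (\<Sum>p\<in>S. w p * (fst p ^ r * snd p ^ s)) = 0"
  shows "k + 2 \<le> card S"
proof (rule ccontr)
  assume small: "\<not> k + 2 \<le> card S"
  obtain p where p: "p \<in> S" using assms(2) by blast
  obtain ls where ls: "length ls = card (S - {p})" "(\<Prod>l\<leftarrow>ls. affine_form l p) \<noteq> 0"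
    "\<And>t. t \<in> S - {p} \<Longrightarrow> (\<Prod>l\<leftarrow>ls. affine_form l t) = 0"
    using prod_list_affine_separates[of "S - {p}" p] assms(1) by blast
  have "length ls \<le> k" using ls(1) small p assms(1) by simp
  with ls(2,3) show False
    using prod_list_affine_not_isolating[OF assms(1) p assms(3)[OF p] assms(4)] by blast
qed

text \<open>A line through two points of \<open>S\<close> spends one factor on both. If it missed
  some \<open>p\<close>, the remaining \<open>k - 1\<close> points would need only one factor each,
  and \<open>k\<close> factors would isolate \<open>p\<close>.\<close>

lemma collinear_of_moments_eq_0:
  fixes w :: "'a \<times> 'a \<Rightarrow> 'a::field"
  assumes "finite S" "card S = k + 2" "\<And>p. p \<in> S \<Longrightarrow> w p \<noteq> 0"
    and "\<And>r s. r + s \<le> k \<Longrightarrow> (\<Sum>p\<in>S. w p * (fst p ^ r * snd p ^ s)) = 0"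
  shows "\<exists>L. affine_line L \<and> S \<subseteq> L"
proof -
  obtain u v where uv: "u \<in> S" "v \<in> S" "u \<noteq> v"
    using assms(1,2) card_le_Suc0_iff_eq[of S] by auto
  then obtain l where l: "affine_line {p. affine_form l p = 0}"
    "affine_form l u = 0" "affine_form l v = 0"
    using affine_line_through by blast
  have "S \<subseteq> {p. affine_form l p = 0}"
  proof (rule ccontr)
    assume "\<not> ?thesis"
    then obtain p where p: "p \<in> S" "affine_form l p \<noteq> 0" by blast
    let ?T = "S - {u, v, p}"
    have "p \<noteq> u" "p \<noteq> v" using p(2) l by auto
    with uv have "card {u, v, p} = 3" by simp
    \<comment> \<open>Three distinct points in \<open>S\<close> force \<open>k\<close> to be
      positive, so the truncated subtraction in the cardinality of \<open>?T\<close> is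
      exact.\<close>
    then have T: "card ?T + 1 = k" "3 \<le> k + 2"
      using assms(1,2) uv p card_mono[of S "{u, v, p}"] by (auto simp: card_Diff_subset)
    obtain ls where "length ls = card ?T" "(\<Prod>l\<leftarrow>ls. affine_form l p) \<noteq> 0"
      "\<And>t. t \<in> ?T \<Longrightarrow> (\<Prod>l\<leftarrow>ls. affine_form l t) = 0"
      using prod_list_affine_separates[of ?T p] assms(1) by blast
    with T p l show False
      using prod_list_affine_not_isolating[OF assms(1) p(1) assms(3)[OF p(1)] assms(4), of k "l # ls"]
      by auto
  qed
  with l(1) show ?thesis by blast
qed

section \<open>A word of weight at most \<open>d\<close>\<close>

text \<open>Counting replaces linear algebra: there are more weight functions on \<open>Y\<close>
  than lists of \<open>k\<close> power sums, so two different ones share all sums, and their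
  difference is the relation.\<close>

lemma exists_power_relation:
  fixes Y :: "'a::{finite,field} set"
  assumes "k < card Y"
  obtains w where "\<exists>y\<in>Y. w y \<noteq> 0" "\<And>s. s < k \<Longrightarrow> (\<Sum>y\<in>Y. w y * y ^ s) = 0"
proof -
  let ?A = "Y \<rightarrow>\<^sub>E (UNIV :: 'a set)" and ?B = "{..<k} \<rightarrow>\<^sub>E (UNIV :: 'a set)"
  let ?f = "\<lambda>w. \<lambda>s\<in>{..<k}. \<Sum>y\<in>Y. w y * y ^ s"
  have "1 < CARD('a)" using card_mono[of UNIV "{0, 1 :: 'a}"] by simp
  then have "card ?B < card ?A" using assms by (simp add: card_funcsetE)
  moreover have "?f ` ?A \<subseteq> ?B" by (rule image_subsetI) simp
  ultimately have "\<not> inj_on ?f ?A"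
    using card_inj_on_le[of ?f ?A ?B] by (auto simp: finite_PiE)
  then obtain w1 w2 where w: "w1 \<in> ?A" "w2 \<in> ?A" "w1 \<noteq> w2" "?f w1 = ?f w2"
    by (auto simp: inj_on_def)
  show ?thesis
  proof
    \<comment> \<open>Both functions are extensional on \<open>Y\<close>, so they can differ only
      inside \<open>Y\<close>.\<close>
    show "\<exists>y\<in>Y. w1 y - w2 y \<noteq> 0"
      using w(3) PiE_ext[OF w(1,2)] by auto
    fix s assume "s < k"
    then show "(\<Sum>y\<in>Y. (w1 y - w2 y) * y ^ s) = 0"
      using fun_cong[OF w(4), of s] by (simp add: algebra_simps sum_subtractf)
  qed
qed

text \<open>Eliminates the bound \<open>m\<close> and the polynomials, leaving the moment conditions
  in which the other lemmas are phrased.\<close>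

lemma corner_code_iff:
  fixes P :: "nat \<Rightarrow> 'a::{finite,field} \<times> 'a"
  assumes "is_corner_code P q d C"
  shows "c \<in> C \<longleftrightarrow> c \<in> {1..q ^ 3} \<rightarrow>\<^sub>E UNIV \<and>
    (\<forall>r s. r + s \<le> d - 2 \<longrightarrow> (\<Sum>i = 1..q ^ 3. c i * (fst (P i) ^ r * snd (P i) ^ s)) = 0)"
proof -
  obtain m where m: "hermitian_basis m q = ({xy_monom r s | r s. r + s \<le> d - 2} :: 'a poly poly set)"
    and C: "C = hermitian_code P m q"
    using assms unfolding is_corner_code_def by blast
  have eval: "eval_xy (xy_monom r s) p = fst p ^ r * snd p ^ s" for r s and p :: "'a \<times> 'a"
    using eval_xy_monom[of r s "fst p" "snd p"] by simp
  show ?thesis unfolding C hermitian_code_def m by (auto simp flip: eval)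
qed

text \<open>Pigeonhole on the fibres of the first projection.\<close>

lemma vertical_line_many_points:
  assumes "finite (A :: ('a::finite \<times> 'b) set)" "CARD('a) * n \<le> card A"
  obtains x where "n \<le> card {y. (x, y) \<in> A}"
proof (rule ccontr)
  assume "\<not> thesis"
  with that have less: "card {y. (x, y) \<in> A} < n" for x by (meson not_le)
  have fin: "finite {y. (x, y) \<in> A}" for x
    by (rule finite_subset[of _ "snd ` A"]) (use assms(1) in force)+
  have "A = (SIGMA x:UNIV. {y. (x, y) \<in> A})" by auto
  then have "card A = (\<Sum>x\<in>UNIV. card {y. (x, y) \<in> A})"
    using card_SigmaI[of UNIV "\<lambda>x. {y. (x, y) \<in> A}"] fin by simp
  also have "\<dots> < (\<Sum>x\<in>(UNIV :: 'a set). n)"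
    by (rule sum_strict_mono) (use less in auto)
  finally show False using assms(2) by simp
qed

lemma corner_code_light_word:
  fixes P :: "nat \<Rightarrow> 'a::{finite,field} \<times> 'a"
  assumes "CARD('a) = q\<^sup>2" "2 \<le> d" "d \<le> q" "inj_on P {1..q ^ 3}"
    and "is_corner_code P q d C"
  obtains c where "c \<in> C" "hamming_weight (q ^ 3) c \<noteq> 0" "hamming_weight (q ^ 3) c \<le> d"
proof -
  let ?I = "{1..q ^ 3}"
  have "CARD('a) * q = card (P ` ?I)"
    using assms(1,4) by (simp add: card_image power2_eq_square power3_eq_cube)
  then obtain x where "q \<le> card {y. (x, y) \<in> P ` ?I}"
    using vertical_line_many_points[of "P ` ?I" q] by auto
  with assms(3) obtain Y where Y: "Y \<subseteq> {y. (x, y) \<in> P ` ?I}" "card Y = d"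
    by (meson le_trans obtain_subset_with_card_n)
  \<comment> \<open>On \<open>d\<close> ordinates there is room for \<open>d - 1\<close> conditions,
    namely the exponents up to \<open>d - 2\<close>. Some values of \<open>w\<close> may vanish, so
    the word gets weight at most \<open>d\<close>.\<close>
  obtain w where w: "\<exists>y\<in>Y. w y \<noteq> 0" "\<And>s. s < d - 1 \<Longrightarrow> (\<Sum>y\<in>Y. w y * y ^ s) = 0"
    using exists_power_relation[of "d - 1" Y] Y(2) assms(2) by auto
  define J where "J = {i \<in> ?I. P i \<in> {x} \<times> Y}"
  define c where "c = (\<lambda>i\<in>?I. if i \<in> J then w (snd (P i)) else 0)"
  \<comment> \<open>All points indexed by \<open>J\<close> have abscissa \<open>x\<close>, so the
    ordinate determines the point, and \<open>P\<close> is injective.\<close>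
  have J: "bij_betw (\<lambda>i. snd (P i)) J Y"
    unfolding bij_betw_def
  proof
    show "inj_on (\<lambda>i. snd (P i)) J"
      using assms(4) by (auto simp: inj_on_def J_def prod_eq_iff)
    show "(\<lambda>i. snd (P i)) ` J = Y"
    proof
      show "(\<lambda>i. snd (P i)) ` J \<subseteq> Y" by (auto simp: J_def)
      show "Y \<subseteq> (\<lambda>i. snd (P i)) ` J"
      proof
        fix y assume "y \<in> Y"
        with Y(1) obtain i where "i \<in> ?I" "(x, y) = P i" by blast
        with \<open>y \<in> Y\<close> show "y \<in> (\<lambda>i. snd (P i)) ` J"
          by (intro image_eqI[of _ _ i]) (auto simp: J_def simp flip: \<open>(x, y) = P i\<close>)
      qed
    qed
  qed
  have JI: "J \<subseteq> ?I" by (auto simp: J_def)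
  then have finJ: "finite J" by (rule finite_subset) simp
  have "(\<Sum>i\<in>?I. c i * (fst (P i) ^ r * snd (P i) ^ s)) = 0" if "r + s \<le> d - 2" for r s
  proof -
    \<comment> \<open>On the vertical line \<open>x ^ r\<close> is a constant factor, which leaves a
      power sum in the ordinates.\<close>
    have "(\<Sum>i\<in>?I. c i * (fst (P i) ^ r * snd (P i) ^ s)) =
          (\<Sum>i\<in>J. x ^ r * (w (snd (P i)) * snd (P i) ^ s))"
      by (rule sum.mono_neutral_cong_right) (use JI in \<open>auto simp: c_def J_def\<close>)
    also have "\<dots> = x ^ r * (\<Sum>y\<in>Y. w y * y ^ s)"
      using sum.reindex_bij_betw[OF J, of "\<lambda>y. w y * y ^ s"] by (simp flip: sum_distrib_left)
    also have "\<dots> = 0" using w(2)[of s] that assms(2) by simp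
    finally show ?thesis .
  qed
  then have "c \<in> C" unfolding corner_code_iff[OF assms(5)] by (auto simp: c_def)
  moreover have "word_support (q ^ 3) c \<subseteq> J"
    by (auto simp: word_support_def c_def split: if_splits)
  then have "hamming_weight (q ^ 3) c \<le> d"
    using card_mono[OF finJ] bij_betw_same_card[OF J] Y(2) by (simp add: hamming_weight_def)
  moreover obtain i where "i \<in> J" "w (snd (P i)) \<noteq> 0"
    using w(1) bij_betw_imp_surj_on[OF J] by auto
  then have "i \<in> word_support (q ^ 3) c" using JI by (auto simp: word_support_def c_def)
  then have "hamming_weight (q ^ 3) c \<noteq> 0" by (auto simp: hamming_weight_def word_support_def)
  ultimately show ?thesis using that by blast
qed

theorem proposition4p7:
  fixes q d :: nat
    and P :: "nat \<Rightarrow> 'a::{finite,field} \<times> 'a"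
    and C :: "(nat \<Rightarrow> 'a) set"
    and c :: "nat \<Rightarrow> 'a"
  assumes "primepow q"
    and "CARD('a) = q\<^sup>2"
    and "2 \<le> d" and "d \<le> q"
    and "bij_betw P {1..q ^ 3} (hermitian_curve q)"
    and "is_corner_code P q d C"
    and "minimum_weight_word (q ^ 3) C c"
  shows "card (word_points P (q ^ 3) c) = d \<and>
         (\<exists>L. affine_line L \<and> word_points P (q ^ 3) c \<subseteq> L)"
proof -
  let ?I = "{1..q ^ 3}" and ?J = "word_support (q ^ 3) c" and ?S = "word_points P (q ^ 3) c"
  have inj: "inj_on P ?I" using assms(5) by (rule bij_betw_imp_inj_on)
  have J: "?J \<subseteq> ?I" by (auto simp: word_support_def)
  have injJ: "inj_on P ?J" using inj J by (rule inj_on_subset)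
  have cardS: "card ?S = hamming_weight (q ^ 3) c"
    using injJ by (simp add: word_points_def hamming_weight_def card_image)
  obtain c' where "c' \<in> C" "hamming_weight (q ^ 3) c' \<noteq> 0" "hamming_weight (q ^ 3) c' \<le> d"
    using corner_code_light_word[OF assms(2-4) inj assms(6)] by blast
  then have le: "card ?S \<le> d" and nz: "card ?S \<noteq> 0" and c: "c \<in> C"
    using assms(7) cardS unfolding minimum_weight_word_def by (auto intro: le_trans)
  \<comment> \<open>Transports the word from indices to points of the curve, so that the lemmas on
    sets of points apply.\<close>
  define w where "w p = c (the_inv_into ?I P p)" for p
  have w: "w (P i) = c i" if "i \<in> ?I" for i
    using that inj by (simp add: w_def the_inv_into_f_f)
  have w_nz: "w p \<noteq> 0" if "p \<in> ?S" for p
    using that w J by (auto simp: word_points_def word_support_def)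
  have moments: "(\<Sum>p\<in>?S. w p * (fst p ^ r * snd p ^ s)) = 0" if "r + s \<le> d - 2" for r s
  proof -
    have "(\<Sum>p\<in>?S. w p * (fst p ^ r * snd p ^ s)) =
          (\<Sum>i\<in>?J. w (P i) * (fst (P i) ^ r * snd (P i) ^ s))"
      using injJ by (simp add: word_points_def sum.reindex)
    also have "\<dots> = (\<Sum>i\<in>?I. c i * (fst (P i) ^ r * snd (P i) ^ s))"
      by (rule sum.mono_neutral_cong_left) (use J w in \<open>auto simp: word_support_def\<close>)
    also have "\<dots> = 0" using c that unfolding corner_code_iff[OF assms(6)] by blast
    finally show ?thesis .
  qed
  \<comment> \<open>The lower bound with \<open>k = d - 2\<close> meets the upper bound
    \<open>le\<close> from the light word, so the weight is exactly \<open>d\<close>.\<close>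
  have "d - 2 + 2 \<le> card ?S"
    using card_gt_of_moments_eq_0[OF _ _ w_nz moments] nz by fastforce
  with le assms(3) have card: "card ?S = d - 2 + 2" by simp
  show ?thesis
    using collinear_of_moments_eq_0[OF _ card w_nz moments] card assms(3) by simp
qed

end
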